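(* Let $u,d$ be real numbers with $0<d\le 1\le u$ and $u\neq d$. Then $$\lim_{n\rightarrow \infty} G(n,u,d)= \begin{cases} 1,&\text{if } ud>1,\\ 0,&\text{if } ud=1,\\ -1,&\text{if } ud<1. \end{cases}$$
   Context: For $n\in\mathbb{N}$, $n\ge 1$, and real $0<d\le 1\le u$ with $u\ne d$, define $$\widetilde{k}_0(n,u,d)=\left\lfloor n \cdot \frac{\ln(1/d)}{\ln(u/d)} \right\rfloor\in\{0,\ldots,n\}$$ and $$G(n,u,d)=\left(\frac{1}{2} \right)^n \left[\sum_{k=0}^{\widetilde{k}_0(n,u,d)} \binom{n}{k} \left(u^k d^{n-k} - 1 \right) + \sum_{k = \widetilde{k}_0(n,u,d) + 1}^n \binom{n}{k} \right].$$ Equivalently, $$G(n,u,d)=-1+\left(\frac{1}{2} \right)^n \sum_{k=0}^{\widetilde{k}_0(n,u,d)}\binom{n}{k} u^k d^{n-k}+\left(\frac{1}{2} \right)^{n-1} \sum_{k=\widetilde{k}_0(n,u,d)+1}^n\binom{n}{k}.$$ (Interpretation: $G(n,u,d)$ is the expected net profit for stake $1$ after $n$ independent fair coin tosses, where heads multiplies the score by $u$ and tails by $d$; with $k$ heads, the net profit is $1$ if $u^kd^{n-k}>1$ and $u^kd^{n-k}-1$ otherwise.) Sums over empty index ranges are $0$. *)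

theory Defs
  imports Complex_Main
begin

(* For 0 < d <= 1 <= u with u ~= d the argument of the floor lies in [0, n],
   so the conversion by nat never truncates a negative integer. *)
definition k0 :: "nat \<Rightarrow> real \<Rightarrow> real \<Rightarrow> nat" where
  "k0 n u d = nat \<lfloor>real n * (ln (1 / d) / ln (u / d))\<rfloor>"

definition G :: "nat \<Rightarrow> real \<Rightarrow> real \<Rightarrow> real" where
  "G n u d =
     (1 / 2) ^ n *
       ((\<Sum>k = 0..k0 n u d. real (n choose k) * (u ^ k * d ^ (n - k) - 1))
        + (\<Sum>k = k0 n u d + 1..n. real (n choose k)))"

end

theory Submission
  imports Defs
begin

text \<open>
  The limit is decided by the typical size of the score \<open>u\<^sup>k d\<^sup>n\<^sup>-\<^sup>k\<close> after \<open>n\<close> tosses with \<open>k\<close>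
  heads.  The typical value is \<open>(ud)\<^sup>n\<^sup>/\<^sup>2\<close>, so for \<open>ud > 1\<close> the score is almost always huge
  (profit \<open>1\<close>), and for \<open>ud < 1\<close> it is almost always tiny (profit \<open>-1\<close>).

  Both statements follow from one exponential moment bound.  If \<open>ab < 1\<close>, then
  \<open>s \<mapsto> a\<^sup>s + b\<^sup>s\<close> has the value \<open>2\<close> and the slope \<open>ln (ab) < 0\<close> at \<open>0\<close>, so \<open>a\<^sup>s + b\<^sup>s < 2\<close> for some
  \<open>0 < s \<le> 1\<close>.  The mean of the \<open>s\<close>-th power of \<open>a\<^sup>k b\<^sup>n\<^sup>-\<^sup>k\<close> is \<open>((a\<^sup>s + b\<^sup>s) / 2)\<^sup>n\<close> by the binomial
  theorem and hence tends to \<open>0\<close> (\<open>binomial_moment_tendsto_0\<close>).  The distance of the profit from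
  its limit is at most twice such a power, with \<open>(a, b) = (u, d)\<close> if \<open>ud < 1\<close> and
  \<open>(a, b) = (1/u, 1/d)\<close> if \<open>ud > 1\<close>.

  For \<open>ud = 1\<close> the score is \<open>d\<^sup>n\<^sup>-\<^sup>2\<^sup>k\<close> and the threshold is \<open>k \<le> n/2\<close>.  By the symmetry of the
  binomial coefficients, gains and losses of size \<open>1\<close> cancel up to one central coefficient; the
  remaining scores below the threshold form a geometric sum, again bounded by a multiple of
  the central coefficient.  So everything is of the order of the central coefficient divided by
  \<open>2\<^sup>n\<close>, which is at most \<open>1 / sqrt n\<close> (\<open>central_binomial_squared_le\<close>).
\<close>

section \<open>The profit as a function of the score\<close>

text \<open>The floor in \<open>k0\<close> solves the inequality \<open>k ln u + (n - k) ln d \<le> 0\<close> for \<open>k\<close>.\<close>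

lemma le_k0_iff:
  fixes u d :: real
  assumes "0 < d" "d \<le> 1" "1 \<le> u" "u \<noteq> d" "k \<le> n"
  shows "k \<le> k0 n u d \<longleftrightarrow> u ^ k * d ^ (n - k) \<le> 1"
proof -
  have L: "ln (u / d) > 0" using assms by simp
  have nonneg: "0 \<le> real n * (ln (1 / d) / ln (u / d))"
    using assms L by (intro mult_nonneg_nonneg divide_nonneg_pos) auto
  have "k \<le> k0 n u d \<longleftrightarrow> real k \<le> real n * (ln (1 / d) / ln (u / d))"
    unfolding k0_def using nonneg by (simp add: le_nat_iff le_floor_iff)
  also have "\<dots> \<longleftrightarrow> real k * ln (u / d) \<le> real n * ln (1 / d)"
    using L by (simp add: pos_le_divide_eq)
  also have "\<dots> \<longleftrightarrow> real k * ln u + real (n - k) * ln d \<le> 0"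
    using assms by (simp add: ln_div of_nat_diff algebra_simps)
  also have "real k * ln u + real (n - k) * ln d = ln (u ^ k * d ^ (n - k))"
    using assms by (simp add: ln_mult ln_realpow)
  also have "\<dots> \<le> 0 \<longleftrightarrow> u ^ k * d ^ (n - k) \<le> 1"
    using assms by (subst ln_le_zero_iff) auto
  finally show ?thesis .
qed

lemma G_eq_mean_profit:
  fixes u d :: real
  assumes "0 < d" "d \<le> 1" "1 \<le> u" "u \<noteq> d"
  shows "G n u d = (1 / 2) ^ n * (\<Sum>k\<le>n. real (n choose k) *
           (if u ^ k * d ^ (n - k) \<le> 1 then u ^ k * d ^ (n - k) - 1 else 1))"
proof -
  let ?f = "\<lambda>k. real (n choose k) *
           (if u ^ k * d ^ (n - k) \<le> 1 then u ^ k * d ^ (n - k) - 1 else 1)"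
  define m where "m = k0 n u d"
  have le_m: "k \<le> m \<longleftrightarrow> u ^ k * d ^ (n - k) \<le> 1" if "k \<le> n" for k
    unfolding m_def using le_k0_iff[OF assms that] .
  have low: "(\<Sum>k = 0..m. real (n choose k) * (u ^ k * d ^ (n - k) - 1)) =
             (\<Sum>k\<in>{..n} \<inter> {..m}. ?f k)"
    by (rule sum.mono_neutral_cong_right) (auto simp: le_m)
  have high: "(\<Sum>k = m + 1..n. real (n choose k)) = (\<Sum>k\<in>{..n} - {..m}. ?f k)"
    by (rule sum.cong) (auto simp: le_m[symmetric])
  have "sum ?f {..n} = (\<Sum>k\<in>{..n} \<inter> {..m}. ?f k) + (\<Sum>k\<in>{..n} - {..m}. ?f k)"
    by (rule sum.Int_Diff) simp
  then show ?thesis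
    unfolding G_def m_def[symmetric] low high by simp
qed

section \<open>The unbalanced cases\<close>

lemma ex_powr_sum_less_2:
  fixes a b :: real
  assumes "0 < a" "0 < b" "a * b < 1"
  shows "\<exists>s. 0 < s \<and> s \<le> 1 \<and> a powr s + b powr s < 2"
proof -
  have deriv: "((\<lambda>s. a powr s + b powr s) has_real_derivative ln (a * b)) (at 0)"
    using assms by (auto intro!: derivative_eq_intros simp: ln_mult)
  have "ln (a * b) < 0" using assms by simp
  from DERIV_neg_dec_right[OF deriv this] obtain e where
    e: "e > 0" "\<And>h. 0 < h \<Longrightarrow> h < e \<Longrightarrow> a powr (0 + h) + b powr (0 + h) < a powr 0 + b powr 0"
    by auto
  have "a powr min 1 (e / 2) + b powr min 1 (e / 2) < 2"
    using e(2)[of "min 1 (e / 2)"] \<open>e > 0\<close> assms by (auto simp: min_def)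
  then show ?thesis
    using \<open>e > 0\<close> by (intro exI[of _ "min 1 (e / 2)"]) auto
qed

text \<open>The \<open>s\<close>-th power of the score is a product over independent tosses, so its mean is the
  \<open>n\<close>-th power of the mean for one toss.\<close>

lemma binomial_moment:
  fixes a b s :: real
  assumes "0 < a" "0 < b"
  shows "(1 / 2) ^ n * (\<Sum>k\<le>n. real (n choose k) * (a ^ k * b ^ (n - k)) powr s) =
         ((a powr s + b powr s) / 2) ^ n"
proof -
  have pw: "(a ^ k * b ^ j) powr s = (a powr s) ^ k * (b powr s) ^ j" for k j
    using assms by (simp add: powr_mult powr_realpow[symmetric] powr_powr mult.commute)
  show ?thesis
    unfolding pw by (simp add: binomial_ring power_divide mult.assoc)
qed

lemma binomial_moment_tendsto_0:
  fixes a b :: real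
  assumes "0 < a" "0 < b" "a * b < 1"
  obtains s where "0 < s" "s \<le> 1"
    "(\<lambda>n. (1 / 2) ^ n * (\<Sum>k\<le>n. real (n choose k) * (a ^ k * b ^ (n - k)) powr s)) \<longlonglongrightarrow> 0"
proof -
  obtain s where s: "0 < s" "s \<le> 1" "a powr s + b powr s < 2"
    using ex_powr_sum_less_2[OF assms] by blast
  have "(\<lambda>n. ((a powr s + b powr s) / 2) ^ n) \<longlonglongrightarrow> 0"
    using s by (intro LIMSEQ_power_zero) simp
  then show ?thesis
    using that s binomial_moment[OF assms(1,2)] by simp
qed

text \<open>A profit that differs from the constant \<open>c\<close> by at most \<open>2 (a\<^sup>k b\<^sup>n\<^sup>-\<^sup>k)\<^sup>s\<close> has a mean that
  differs from \<open>c\<close> by at most twice the moment, because the weights add up to \<open>1\<close>.\<close>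

lemma binomial_mean_tendsto:
  fixes g h :: "nat \<Rightarrow> nat \<Rightarrow> real"
  assumes bound: "\<And>n k. k \<le> n \<Longrightarrow> \<bar>g n k - c\<bar> \<le> 2 * h n k"
    and lim: "(\<lambda>n. (1 / 2) ^ n * (\<Sum>k\<le>n. real (n choose k) * h n k)) \<longlonglongrightarrow> 0"
  shows "(\<lambda>n. (1 / 2) ^ n * (\<Sum>k\<le>n. real (n choose k) * g n k)) \<longlonglongrightarrow> c"
proof -
  have "\<bar>(1 / 2) ^ n * (\<Sum>k\<le>n. real (n choose k) * g n k) - c\<bar> \<le>
        2 * ((1 / 2) ^ n * (\<Sum>k\<le>n. real (n choose k) * h n k))" for n
  proof -
    have total: "(\<Sum>k\<le>n. real (n choose k)) = 2 ^ n"
      using choose_row_sum[of n] by (metis of_nat_sum of_nat_power of_nat_numeral)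
    have "c = (1 / 2) ^ n * (\<Sum>k\<le>n. real (n choose k) * c)"
      by (simp add: sum_distrib_right[symmetric] total power_divide)
    then have "\<bar>(1 / 2) ^ n * (\<Sum>k\<le>n. real (n choose k) * g n k) - c\<bar> =
        \<bar>(1 / 2) ^ n * (\<Sum>k\<le>n. real (n choose k) * (g n k - c))\<bar>"
      by (simp add: right_diff_distrib sum_subtractf)
    also have "\<dots> = (1 / 2) ^ n * \<bar>\<Sum>k\<le>n. real (n choose k) * (g n k - c)\<bar>"
      by (simp add: abs_mult)
    also have "\<bar>\<Sum>k\<le>n. real (n choose k) * (g n k - c)\<bar> \<le>
               (\<Sum>k\<le>n. real (n choose k) * (2 * h n k))"
      by (rule order.trans[OF sum_abs sum_mono])
        (auto simp: abs_mult intro!: mult_left_mono bound)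
    finally show ?thesis
      by (simp add: sum_distrib_left mult.left_commute)
  qed
  then have "(\<lambda>n. (1 / 2) ^ n * (\<Sum>k\<le>n. real (n choose k) * g n k) - c) \<longlonglongrightarrow> 0"
    by (intro tendsto_0_le[OF lim, of _ 2] always_eventually allI)
      (smt (verit) real_norm_def)
  then show ?thesis
    by (simp add: LIM_zero_iff)
qed

lemma G_tendsto_of_ud_less_1:
  fixes u d :: real
  assumes "0 < d" "d \<le> 1" "1 \<le> u" "u \<noteq> d" "u * d < 1"
  shows "(\<lambda>n. G n u d) \<longlonglongrightarrow> -1"
proof -
  obtain s where s: "0 < s" "s \<le> 1"
    and lim: "(\<lambda>n. (1 / 2) ^ n *
               (\<Sum>k\<le>n. real (n choose k) * (u ^ k * d ^ (n - k)) powr s)) \<longlonglongrightarrow> 0"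
    using binomial_moment_tendsto_0[of u d] assms by auto
  (* The profit exceeds -1 by x if x \<le> 1 and by 2 otherwise; s \<le> 1 is used for x \<le> x powr s. *)
  have profit: "\<bar>(if x \<le> 1 then x - 1 else 1) - (- 1)\<bar> \<le> 2 * x powr s" if "0 < x" for x :: real
  proof (cases "x \<le> 1")
    case True
    have "x powr 1 \<le> x powr s"
      by (rule powr_mono') (use True s that in auto)
    then show ?thesis using True that by simp
  next
    case False
    then show ?thesis using s by (simp add: ge_one_powr_ge_zero)
  qed
  show ?thesis
    unfolding G_eq_mean_profit[OF assms(1-4)]
    by (rule binomial_mean_tendsto[OF _ lim], rule profit) (use assms in simp)
qed

lemma G_tendsto_of_ud_greater_1:
  fixes u d :: real
  assumes "0 < d" "d \<le> 1" "1 \<le> u" "u \<noteq> d" "u * d > 1"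
  shows "(\<lambda>n. G n u d) \<longlonglongrightarrow> 1"
proof -
  have "(1 / u) * (1 / d) < 1" using assms by (simp add: field_simps)
  then obtain s where s: "0 < s" "s \<le> 1"
    and lim: "(\<lambda>n. (1 / 2) ^ n *
               (\<Sum>k\<le>n. real (n choose k) * ((1 / u) ^ k * (1 / d) ^ (n - k)) powr s)) \<longlonglongrightarrow> 0"
    using binomial_moment_tendsto_0[of "1 / u" "1 / d"] assms by auto
  (* The profit falls short of 1 only for scores x \<le> 1, and then by 2 - x. *)
  have profit: "\<bar>(if x \<le> 1 then x - 1 else 1) - 1\<bar> \<le> 2 * (1 / x) powr s" if "0 < x" for x :: real
  proof (cases "x \<le> 1")
    case True
    then have "1 \<le> (1 / x) powr s"
      using that s by (intro ge_one_powr_ge_zero) auto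
    then have "2 \<le> 2 * (1 / x) powr s" by simp
    then show ?thesis using True that by (simp del: mult_le_cancel_left1)
  qed auto
  have inv: "(1 / u) ^ k * (1 / d) ^ j = 1 / (u ^ k * d ^ j)" for k j
    by (simp add: power_one_over field_simps)
  show ?thesis
    unfolding G_eq_mean_profit[OF assms(1-4)]
    by (rule binomial_mean_tendsto[OF _ lim], unfold inv, rule profit) (use assms in simp)
qed

section \<open>The balanced case\<close>

text \<open>The square turns the recursion into \<open>(2m + 1)(2m + 3) \<le> (2m + 2)\<^sup>2\<close>.\<close>

lemma even_central_binomial_squared_le:
  "((2 * m) choose m)\<^sup>2 * (2 * m + 1) \<le> (4 ^ (2 * m) :: nat)"
proof (induction m)
  case (Suc m)
  have step: "(m + 1) * ((2 * Suc m) choose Suc m) = 2 * (2 * m + 1) * ((2 * m) choose m)"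
  proof -
    have "(m + 1) * ((2 * Suc m) choose Suc m) = 2 * ((m + 1) * ((2 * m + 1) choose m))"
      using Suc_times_binomial[of m "2 * m + 1"] by simp
    also have "(2 * m + 1) choose m = (2 * m + 1) choose (m + 1)"
      using binomial_symmetric[of m "2 * m + 1"] by simp
    also have "(m + 1) * ((2 * m + 1) choose (m + 1)) = (2 * m + 1) * ((2 * m) choose m)"
      using Suc_times_binomial[of m "2 * m"] by simp
    finally show ?thesis by simp
  qed
  have "(m + 1)\<^sup>2 * (((2 * Suc m) choose Suc m)\<^sup>2 * (2 * Suc m + 1)) =
        ((m + 1) * ((2 * Suc m) choose Suc m))\<^sup>2 * (2 * m + 3)"
    by (simp only: power_mult_distrib) (simp only: algebra_simps, simp)
  also have "\<dots> = 4 * ((2 * m + 1) * (2 * m + 3)) * (((2 * m) choose m)\<^sup>2 * (2 * m + 1))"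
    unfolding step by (simp add: power2_eq_square algebra_simps)
  also have "\<dots> \<le> 4 * (4 * (m + 1)\<^sup>2) * 4 ^ (2 * m)"
  proof (rule mult_mono[OF _ Suc.IH])
    show "4 * ((2 * m + 1) * (2 * m + 3)) \<le> 4 * (4 * (m + 1)\<^sup>2)"
      by (simp add: power2_eq_square algebra_simps)
  qed auto
  also have "\<dots> = (m + 1)\<^sup>2 * 4 ^ (2 * Suc m)" by simp
  finally show ?case by simp
qed simp

text \<open>Odd \<open>n\<close> reduce to \<open>n - 1\<close>, since by Pascal's rule a central coefficient is at most twice that
  of the row above.\<close>

lemma central_binomial_squared_le: "(n choose (n div 2))\<^sup>2 * n \<le> (4 ^ n :: nat)"
proof -
  define m where "m = n div 2"
  consider "n = 2 * m" | "n = 2 * m + 1" unfolding m_def by linarith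
  then show ?thesis
  proof cases
    case 1
    have "((2 * m) choose m)\<^sup>2 * (2 * m) \<le> ((2 * m) choose m)\<^sup>2 * (2 * m + 1)" by simp
    also note even_central_binomial_squared_le
    finally show ?thesis using 1 by simp
  next
    case 2
    have "(2 * m + 1) choose m \<le> 2 * ((2 * m) choose m)"
      using binomial_maximum'[of m "m - 1"] by (cases m) auto
    then have "((2 * m + 1) choose m)\<^sup>2 * (2 * m + 1) \<le> (2 * ((2 * m) choose m))\<^sup>2 * (2 * m + 1)"
      by (intro mult_right_mono power_mono) auto
    also have "\<dots> = 4 * (((2 * m) choose m)\<^sup>2 * (2 * m + 1))"
      by (simp add: power_mult_distrib)
    also have "\<dots> \<le> 4 * 4 ^ (2 * m)"
      using even_central_binomial_squared_le[of m] by (rule mult_left_mono) simp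
    finally show ?thesis using 2 by simp
  qed
qed

lemma central_binomial_le:
  assumes "n > 0"
  shows "(1 / 2) ^ n * real (n choose (n div 2)) \<le> 1 / sqrt (real n)"
proof -
  have "real ((n choose (n div 2))\<^sup>2 * n) \<le> real (4 ^ n)"
    using central_binomial_squared_le[of n] by (simp only: of_nat_le_iff)
  then have "sqrt ((real (n choose (n div 2)))\<^sup>2 * real n) \<le> sqrt ((2 ^ n)\<^sup>2)"
    by (intro real_sqrt_le_mono) (simp add: power2_eq_square power_mult_distrib[symmetric])
  then have "real (n choose (n div 2)) * sqrt (real n) \<le> 2 ^ n"
    by (simp add: real_sqrt_mult)
  then show ?thesis using assms by (simp add: field_simps)
qed

text \<open>Reflection \<open>k \<mapsto> n - k\<close> maps the upper half onto the indices below \<open>n - n div 2\<close>: this is all of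
  the lower half if \<open>n\<close> is odd, and all but its last index if \<open>n\<close> is even.\<close>

lemma binomial_half_sums_diff:
  fixes n :: nat
  defines "D \<equiv> (\<Sum>k = 0..n div 2. real (n choose k)) - (\<Sum>k = n div 2 + 1..n. real (n choose k))"
  shows "0 \<le> D" "D \<le> real (n choose (n div 2))"
proof -
  have "(\<Sum>k = n div 2 + 1..n. real (n choose k)) = (\<Sum>k<n - n div 2. real (n choose k))"
    by (rule sum.reindex_bij_witness[of _ "\<lambda>k. n - k" "\<lambda>k. n - k"])
      (auto simp: binomial_symmetric[symmetric])
  moreover have "(\<Sum>k = 0..n div 2. real (n choose k)) =
      (\<Sum>k<n div 2. real (n choose k)) + real (n choose (n div 2))"
    by (simp add: atLeast0AtMost lessThan_Suc_atMost[symmetric])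
  moreover have "n - n div 2 = n div 2 \<or> n - n div 2 = Suc (n div 2)" by linarith
  ultimately show "0 \<le> D" "D \<le> real (n choose (n div 2))"
    unfolding D_def by auto
qed

text \<open>Below the threshold the score is \<open>d\<^sup>n\<^sup>-\<^sup>2\<^sup>k\<close>, at most \<open>d\<^sup>m\<^sup>-\<^sup>k\<close> with \<open>m = n div 2\<close>, so the scores are
  dominated by a geometric series.\<close>

lemma balanced_low_scores_le:
  fixes u d :: real
  assumes "0 < d" "d < 1" "u * d = 1"
  shows "(\<Sum>k = 0..n div 2. real (n choose k) * (u ^ k * d ^ (n - k))) \<le>
         real (n choose (n div 2)) * (1 / (1 - d))"
proof -
  let ?m = "n div 2"
  have "(\<Sum>k = 0..?m. real (n choose k) * (u ^ k * d ^ (n - k))) \<le>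
        (\<Sum>k = 0..?m. real (n choose ?m) * d ^ (?m - k))"
  proof (rule sum_mono)
    fix k assume "k \<in> {0..?m}"
    then have k: "2 * k \<le> n" "?m - k \<le> n - 2 * k" by auto
    have "u ^ k * d ^ (n - k) = (u * d) ^ k * d ^ (n - 2 * k)"
      using k by (simp add: power_mult_distrib power_add[symmetric])
    also have "\<dots> \<le> d ^ (?m - k)"
      using assms k by (simp add: power_decreasing)
    finally have score: "u ^ k * d ^ (n - k) \<le> d ^ (?m - k)" .
    have "0 < u" using assms by (metis zero_less_mult_pos2 zero_less_one)
    then show "real (n choose k) * (u ^ k * d ^ (n - k)) \<le> real (n choose ?m) * d ^ (?m - k)"
      using score assms by (intro mult_mono) (auto simp: binomial_maximum)
  qed
  also have "\<dots> = real (n choose ?m) * (\<Sum>j<Suc ?m. d ^ j)"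
  proof -
    have "(\<Sum>k = 0..?m. d ^ (?m - k)) = (\<Sum>j<Suc ?m. d ^ j)"
      by (rule sum.reindex_bij_witness[of _ "\<lambda>k. ?m - k" "\<lambda>k. ?m - k"]) auto
    then show ?thesis by (simp only: sum_distrib_left[symmetric])
  qed
  also have "(\<Sum>j<Suc ?m. d ^ j) = (1 - d ^ Suc ?m) / (1 - d)"
    using assms by (subst sum_gp_strict) auto
  also have "real (n choose ?m) * \<dots> \<le> real (n choose ?m) * (1 / (1 - d))"
    using assms by (intro mult_left_mono divide_right_mono) auto
  finally show ?thesis .
qed

lemma k0_balanced:
  fixes u d :: real
  assumes "0 < d" "d < 1" "u * d = 1"
  shows "k0 n u d = n div 2"
proof -
  have u: "u = 1 / d" using assms by (simp add: field_simps)
  have "u / d = (1 / d)\<^sup>2" unfolding u by (simp add: power2_eq_square)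
  then have "ln (u / d) = 2 * ln (1 / d)" using assms by (simp only: ln_realpow)
  moreover have "ln (1 / d) \<noteq> 0" using assms by simp
  ultimately have "ln (1 / d) / ln (u / d) = 1 / 2" by simp
  then have "k0 n u d = nat \<lfloor>real n / real 2\<rfloor>" by (simp add: k0_def)
  then show ?thesis by (simp only: floor_divide_of_nat_eq nat_int)
qed

lemma G_tendsto_of_ud_eq_1:
  fixes u d :: real
  assumes "0 < d" "d < 1" "u * d = 1"
  shows "(\<lambda>n. G n u d) \<longlonglongrightarrow> 0"
proof -
  have bound: "\<bar>G n u d\<bar> \<le> 1 / sqrt (real n) * (1 / (1 - d))" if "n > 0" for n
  proof -
    let ?c = "real (n choose (n div 2))"
    let ?A = "\<Sum>k = 0..n div 2. real (n choose k) * (u ^ k * d ^ (n - k))"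
    let ?D = "(\<Sum>k = 0..n div 2. real (n choose k)) - (\<Sum>k = n div 2 + 1..n. real (n choose k))"
    have "0 < u" using assms by (metis zero_less_mult_pos2 zero_less_one)
    then have "0 \<le> ?A" using assms by (intro sum_nonneg) simp
    moreover have "?A \<le> ?c * (1 / (1 - d))" by (rule balanced_low_scores_le[OF assms])
    moreover have "0 \<le> ?D" "?D \<le> ?c" by (rule binomial_half_sums_diff)+
    moreover have "?c * 1 \<le> ?c * (1 / (1 - d))"
      using assms by (intro mult_left_mono) auto
    ultimately have "\<bar>?A - ?D\<bar> \<le> ?c * (1 / (1 - d))" by linarith
    moreover have "G n u d = (1 / 2) ^ n * (?A - ?D)"
      unfolding G_def k0_balanced[OF assms] by (simp only: right_diff_distrib sum_subtractf mult_1_right diff_diff_eq2 diff_add_eq)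
    ultimately have "\<bar>G n u d\<bar> \<le> (1 / 2) ^ n * (?c * (1 / (1 - d)))"
      by (simp only: abs_mult) (intro mult_mono, auto)
    also have "\<dots> = ((1 / 2) ^ n * ?c) * (1 / (1 - d))" by simp
    also have "\<dots> \<le> 1 / sqrt (real n) * (1 / (1 - d))"
      using central_binomial_le[OF that] assms by (intro mult_right_mono) auto
    finally show ?thesis .
  qed
  have "(\<lambda>n. 1 / sqrt (real n)) \<longlonglongrightarrow> 0"
    by (intro tendsto_divide_0[OF tendsto_const] filterlim_at_top_imp_at_infinity
        filterlim_compose[OF sqrt_at_top filterlim_real_sequentially])
  then show ?thesis
    by (rule tendsto_0_le[where K = "1 / (1 - d)"])
      (use bound in \<open>auto intro!: eventually_mono[OF eventually_gt_at_top[of 0]]\<close>)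
qed

theorem theorem4p2:
  fixes u d :: real
  assumes "0 < d" and "d \<le> 1" and "1 \<le> u" and "u \<noteq> d"
  shows "(\<lambda>n. G n u d) \<longlonglongrightarrow>
           (if u * d > 1 then 1 else if u * d = 1 then 0 else -1)"
proof -
  consider "u * d > 1" | "u * d = 1" | "u * d < 1" by linarith
  then show ?thesis
  proof cases
    case 1
    then show ?thesis using G_tendsto_of_ud_greater_1 assms by simp
  next
    case 2
    (* d = 1 would force u = 1 = d. *)
    then have "d < 1" using assms by (cases "d = 1") auto
    then show ?thesis using 2 G_tendsto_of_ud_eq_1 assms by simp
  next
    case 3
    then show ?thesis using G_tendsto_of_ud_less_1 assms by simp
  qed
qed

end
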